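(* The operators $D_0=(1+(x-1)q)(1+(q-1)x)\partial$ and $S_q$ anti-commute, where $S_q(x)=-\frac{1}{qx}$ acts on the space of functions by precomposition; that is, $D_0\circ S_q+S_q\circ D_0=0$.
   Context: $q\in\mathbb{C}^*$ (or a formal parameter), $\partial=\frac{d}{dx}$, and $S_q$ acts on (differentiable) functions $f$ of the coordinate $x$ on $\mathbb{P}^1$ by $(S_qf)(x)=f\left(-\frac{1}{qx}\right)$. *)

theory Defs
  imports "HOL-Analysis.Analysis" "HOL-Computational_Algebra.Computational_Algebra"
begin

text \<open>The coefficient of \<open>\<partial>\<close> in \<open>D\<^sub>0\<close>; polymorphic, so that it serves both for a complex
  number \<open>q\<close> and for a formal parameter \<open>q\<close>.\<close>

definition D0_coeff :: "'a::comm_ring_1 \<Rightarrow> 'a \<Rightarrow> 'a" where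
  "D0_coeff q x = (1 + (x - 1) * q) * (1 + (q - 1) * x)"


section \<open>Complex \<open>q\<close>: functions on the projective line\<close>

datatype P1 = Pt complex | Infty

definition chart_inf :: "complex \<Rightarrow> P1" where
  "chart_inf w = (if w = 0 then Infty else Pt (1 / w))"

text \<open>Differentiability is pointwise, so that \<open>f\<close> may be a function on any part of the projective line
  (with arbitrary values elsewhere); a function differentiable everywhere would be constant.\<close>

primrec P1_differentiable_at :: "(P1 \<Rightarrow> complex) \<Rightarrow> P1 \<Rightarrow> bool" where
  "P1_differentiable_at f (Pt z) \<longleftrightarrow> (\<lambda>x. f (Pt x)) field_differentiable at z"
| "P1_differentiable_at f Infty \<longleftrightarrow> (\<lambda>w. f (chart_inf w)) field_differentiable at 0"

text \<open>In the coordinate \<open>w = 1/x\<close> at infinity, \<open>\<partial> = d/dx\<close> becomes \<open>- w\<^sup>2 d/dw\<close>. Hence \<open>D\<^sub>0\<close> becomes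
  \<open>D0_coeff_inf q w \<cdot> d/dw\<close> (see \<open>D0_coeff_inf_eq\<close>), which is regular at \<open>w = 0\<close>.\<close>

definition D0_coeff_inf :: "complex \<Rightarrow> complex \<Rightarrow> complex" where
  "D0_coeff_inf q w = - ((w + (1 - w) * q) * (w + (q - 1)))"

lemma D0_coeff_inf_eq:
  assumes "w \<noteq> 0"
  shows "D0_coeff_inf q w = - (w\<^sup>2) * D0_coeff q (1 / w)"
  using assms by (simp add: D0_coeff_inf_def D0_coeff_def field_simps power2_eq_square)

primrec D0 :: "complex \<Rightarrow> (P1 \<Rightarrow> complex) \<Rightarrow> P1 \<Rightarrow> complex" where
  "D0 q f (Pt z) = D0_coeff q z * deriv (\<lambda>x. f (Pt x)) z"
| "D0 q f Infty = D0_coeff_inf q 0 * deriv (\<lambda>w. f (chart_inf w)) 0"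

text \<open>The two formulas for \<open>D\<^sub>0\<close> agree on the overlap of the charts.\<close>

lemma D0_chart_inf:
  assumes w: "w \<noteq> 0" and f: "P1_differentiable_at f (chart_inf w)"
  shows "D0 q f (chart_inf w) = D0_coeff_inf q w * deriv (\<lambda>w. f (chart_inf w)) w"
proof -
  define g where "g = (\<lambda>x. f (Pt x))"
  have "g field_differentiable at (1 / w)"
    using w f by (simp add: chart_inf_def g_def)
  then have g: "(g has_field_derivative deriv g (1 / w)) (at (1 / w))"
    by (simp add: field_differentiable_derivI)
  have "((\<lambda>w. 1 / w) has_field_derivative - 1 / w\<^sup>2) (at w)"
    using w by (auto intro!: derivative_eq_intros simp: power2_eq_square)
  from DERIV_chain2[OF g this]
  have "((\<lambda>w. g (1 / w)) has_field_derivative deriv g (1 / w) * (- 1 / w\<^sup>2)) (at w)" .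
  then have "((\<lambda>w. f (chart_inf w)) has_field_derivative deriv g (1 / w) * (- 1 / w\<^sup>2)) (at w)"
    by (rule has_field_derivative_transform_within_open[where S = "- {0}"])
       (use w in \<open>auto simp: chart_inf_def g_def\<close>)
  then have "deriv (\<lambda>w. f (chart_inf w)) w = deriv g (1 / w) * (- 1 / w\<^sup>2)"
    by (rule DERIV_imp_deriv)
  then show ?thesis
    using w by (simp add: D0_coeff_inf_eq chart_inf_def g_def)
qed

primrec Sq_point :: "complex \<Rightarrow> P1 \<Rightarrow> P1" where
  "Sq_point q (Pt x) = (if x = 0 then Infty else Pt (- (1 / (q * x))))"
| "Sq_point q Infty = Pt 0"

definition Sq :: "complex \<Rightarrow> (P1 \<Rightarrow> complex) \<Rightarrow> P1 \<Rightarrow> complex" where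
  "Sq q f = f \<circ> Sq_point q"


section \<open>Formal \<open>q\<close>: rational functions\<close>

text \<open>The functions are the elements of \<open>K(x)\<close>, represented as \<^typ>\<open>'k poly fract\<close>, for a field \<open>K\<close>
  and a nonzero \<open>q \<in> K\<close>. The formal parameter is the case where \<open>q\<close> is the indeterminate of, say,
  \<open>K = \<complex>(q)\<close>.\<close>

definition rat_const :: "'k::field \<Rightarrow> 'k poly fract" where
  "rat_const c = to_fract [:c:]"

definition rat_x :: "'k::field poly fract" where
  "rat_x = to_fract [:0, 1:]"

text \<open>The quotient rule; the value does not depend on the fraction that represents the rational
  function (see \<open>rat_deriv_Fract\<close>).\<close>

definition rat_deriv :: "'k::field poly fract \<Rightarrow> 'k poly fract" where
  "rat_deriv f =
     (THE v. \<exists>a b. b \<noteq> 0 \<and> f = Fract a b \<and> v = Fract (pderiv a * b - a * pderiv b) (b * b))"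

lemma rat_deriv_Fract:
  fixes a b :: "'k::field poly"
  assumes b: "b \<noteq> 0"
  shows "rat_deriv (Fract a b) = Fract (pderiv a * b - a * pderiv b) (b * b)"
  unfolding rat_deriv_def
proof (rule the_equality)
  show "\<exists>c d. d \<noteq> 0 \<and> Fract a b = Fract c d \<and>
      Fract (pderiv a * b - a * pderiv b) (b * b) = Fract (pderiv c * d - c * pderiv d) (d * d)"
    using b by blast
next
  fix v
  assume "\<exists>c d. d \<noteq> 0 \<and> Fract a b = Fract c d \<and> v = Fract (pderiv c * d - c * pderiv d) (d * d)"
  then obtain c d where cd: "d \<noteq> 0" "a * d = c * b"
      "v = Fract (pderiv c * d - c * pderiv d) (d * d)"
    using b by (auto simp: eq_fract)
  have "pderiv (a * d) = pderiv (c * b)" by (simp only: cd)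
  then have "pderiv a * d + a * pderiv d = pderiv c * b + c * pderiv b"
    by (simp add: pderiv_mult algebra_simps)
  with cd(2) have "(pderiv c * d - c * pderiv d) * (b * b) = (pderiv a * b - a * pderiv b) * (d * d)"
    by algebra
  then show "v = Fract (pderiv a * b - a * pderiv b) (b * b)"
    using b cd by (simp add: eq_fract)
qed

definition D0_rat :: "'k::field \<Rightarrow> 'k poly fract \<Rightarrow> 'k poly fract" where
  "D0_rat q f = D0_coeff (rat_const q) rat_x * rat_deriv f"

definition rat_eval :: "'k::field poly \<Rightarrow> 'k poly fract \<Rightarrow> 'k poly fract" where
  "rat_eval p s = poly (map_poly rat_const p) s"

text \<open>Substitution of \<open>-1/(qx)\<close> for \<open>x\<close>; for \<open>q \<noteq> 0\<close> it does not depend on the fraction that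
  represents the rational function (see \<open>Sq_rat_Fract\<close>).\<close>

definition Sq_rat :: "'k::field \<Rightarrow> 'k poly fract \<Rightarrow> 'k poly fract" where
  "Sq_rat q f = (let s = - (1 / (rat_const q * rat_x)) in
     THE v. \<exists>a b. b \<noteq> 0 \<and> f = Fract a b \<and> v = rat_eval a s / rat_eval b s)"

lemma rat_const_0 [simp]: "rat_const 0 = 0"
  and rat_const_1 [simp]: "rat_const 1 = 1"
  and rat_const_add: "rat_const (a + b) = rat_const a + rat_const b"
  and rat_const_mult: "rat_const (a * b) = rat_const a * rat_const b"
  and rat_const_eq_0_iff [simp]: "rat_const a = 0 \<longleftrightarrow> a = 0"
  by (simp_all add: rat_const_def flip: to_fract_add to_fract_mult one_pCons)

lemma rat_eval_pCons [simp]: "rat_eval (pCons c p) s = rat_const c + s * rat_eval p s"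
  by (cases "c = 0 \<and> p = 0") (auto simp: rat_eval_def map_poly_pCons)

lemma rat_eval_0 [simp]: "rat_eval 0 s = 0"
  by (simp add: rat_eval_def)

lemma rat_eval_add: "rat_eval (p + r) s = rat_eval p s + rat_eval r s"
  by (induction p r rule: poly_induct2) (simp_all add: rat_const_add algebra_simps)

lemma rat_eval_smult: "rat_eval (smult c p) s = rat_const c * rat_eval p s"
  by (induction p) (simp_all add: rat_const_mult algebra_simps)

lemma rat_eval_mult: "rat_eval (p * r) s = rat_eval p s * rat_eval r s"
  by (induction p) (simp_all add: rat_eval_add rat_eval_smult algebra_simps)

lemma rat_eval_to_fract: "rat_eval p (to_fract r) = to_fract (pcompose p r)"
  by (induction p) (simp_all add: pcompose_pCons rat_const_def)

lemma rat_eval_Sq_nonzero: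
  fixes b :: "'k::field poly"
  assumes q: "q \<noteq> 0" and b: "b \<noteq> 0"
  shows "rat_eval b (- (1 / (rat_const q * rat_x))) \<noteq> 0"
proof
  define s :: "'k poly fract" where "s = - (1 / (rat_const q * rat_x))"
  assume "rat_eval b (- (1 / (rat_const q * rat_x))) = 0"
  then have 0: "rat_eval b s = 0" by (simp add: s_def)
  have inv: "inverse s = to_fract [:0, - q:]"
    by (simp add: s_def rat_const_def rat_x_def flip: to_fract_mult to_fract_uminus)
  have s: "s \<noteq> 0"
    using q by (auto simp: s_def rat_x_def)
  have "map_poly rat_const (reflect_poly b) = reflect_poly (map_poly rat_const b)"
    by (rule poly_eqI) (simp add: coeff_map_poly coeff_reflect_poly degree_map_poly)
  then have "rat_eval (reflect_poly b) (inverse s) = 0"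
    using poly_reflect_poly_nz[of "inverse s" "map_poly rat_const b"] s 0
    by (simp add: rat_eval_def)
  then have "pcompose (reflect_poly b) [:0, - q:] = 0"
    by (simp add: inv rat_eval_to_fract)
  then show False
    using q b by (auto dest!: pcompose_eq_0)
qed

lemma Sq_rat_Fract:
  assumes q: "q \<noteq> 0" and b: "b \<noteq> 0"
  shows "Sq_rat q (Fract a b) =
    rat_eval a (- (1 / (rat_const q * rat_x))) / rat_eval b (- (1 / (rat_const q * rat_x)))"
proof -
  define s where "s = - (1 / (rat_const q * rat_x))"
  have nz: "rat_eval d s \<noteq> 0" if "d \<noteq> 0" for d
    using rat_eval_Sq_nonzero[OF q that] by (simp add: s_def)
  have "(THE v. \<exists>c d. d \<noteq> 0 \<and> Fract a b = Fract c d \<and> v = rat_eval c s / rat_eval d s)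
      = rat_eval a s / rat_eval b s"
  proof (rule the_equality)
    show "\<exists>c d. d \<noteq> 0 \<and> Fract a b = Fract c d
        \<and> rat_eval a s / rat_eval b s = rat_eval c s / rat_eval d s"
      using b by blast
  next
    fix v
    assume "\<exists>c d. d \<noteq> 0 \<and> Fract a b = Fract c d \<and> v = rat_eval c s / rat_eval d s"
    then obtain c d where cd: "d \<noteq> 0" "a * d = c * b" "v = rat_eval c s / rat_eval d s"
      using b by (auto simp: eq_fract)
    then have "rat_eval a s * rat_eval d s = rat_eval c s * rat_eval b s"
      by (metis rat_eval_mult)
    then show "v = rat_eval a s / rat_eval b s"
      using nz[OF b] nz[OF cd(1)] cd(3) by (simp add: frac_eq_eq mult.commute)
  qed
  then show ?thesis
    by (simp add: Sq_rat_def s_def Let_def)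
qed

end

(* With s(x) = -1/(qx) and c the coefficient of D_0, the chain rule reduces the claim to the identity
   c(x) * s'(x) + c(s(x)) = 0, where s'(x) = 1/(q x^2); the factors of c are exchanged by s up to
   the factor -1/(q x^2). At x = 0 and x = infinity, s is linear when read in the coordinates x and
   w = 1/x, and the same computation is made there. *)

theory Submission
  imports Defs
begin

lemma deriv_mult_left_arg:
  fixes f :: "'a::real_normed_field \<Rightarrow> 'a"
  assumes "f field_differentiable at (c * z)"
  shows "deriv (\<lambda>x. f (c * x)) z = c * deriv f (c * z)"
proof -
  have "(f has_field_derivative deriv f (c * z)) (at (c * z))"
    using assms by (simp add: field_differentiable_derivI)
  moreover have "((\<lambda>x. c * x) has_field_derivative c) (at z)"
    by (auto intro!: derivative_eq_intros)
  ultimately have "((\<lambda>x. f (c * x)) has_field_derivative deriv f (c * z) * c) (at z)"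
    by (rule DERIV_chain2)
  then show ?thesis
    by (simp add: DERIV_imp_deriv mult.commute)
qed

text \<open>With the coordinate w = 1/x on the target, x -> -1/(qx) becomes the scaling by -q, which
  covers x = 0 without a case split. This makes \<open>Sq q f\<close> differentiable there by
  \<open>deriv_mult_left_arg\<close>.\<close>

lemma Sq_Pt_eq_chart_inf:
  assumes "q \<noteq> 0"
  shows "Sq q f (Pt x) = f (chart_inf (- q * x))"
  using assms by (simp add: Sq_def chart_inf_def)

lemma Sq_chart_inf_eq_Pt:
  assumes "q \<noteq> 0"
  shows "Sq q f (chart_inf w) = f (Pt (- (1 / q) * w))"
  using assms by (simp add: Sq_def chart_inf_def)

text \<open>For s = -1/(qx), 1 + (s - 1)q = -(1 + (q - 1)x)/x and 1 + (q - 1)s = (1 + (x -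
  1)q)/(qx). Any field is allowed, so that both the complex numbers and K(x) are covered.\<close>

lemma D0_coeff_Sq:
  fixes q x :: "'a::field"
  assumes "q \<noteq> 0" "x \<noteq> 0"
  shows "D0_coeff q (- (1 / (q * x))) = - D0_coeff q x / (q * x\<^sup>2)"
  using assms by (simp add: D0_coeff_def field_simps power2_eq_square)

text \<open>Differentiability at the image point is what the chain rule asks for, and the second
  term also evaluates \<open>D0 q f\<close> there.\<close>

lemma D0_Sq_anticommute:
  assumes q: "q \<noteq> 0" and f: "P1_differentiable_at f (Sq_point q t)"
  shows "D0 q (Sq q f) t + Sq q (D0 q f) t = 0"
proof (cases t)
  case Infty
  have "deriv (\<lambda>w. f (Pt (- (1 / q) * w))) 0 = - (1 / q) * deriv (\<lambda>x. f (Pt x)) 0"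
    using f Infty deriv_mult_left_arg[of "\<lambda>x. f (Pt x)" "- (1 / q)" 0] by simp
  \<comment> \<open>\<open>D0_coeff_inf q 0\<close> is q(1 - q) and \<open>D0_coeff q 0\<close> is 1
    - q, so the factor -1/q makes the two terms cancel. At x = 0 the factor -q does the
    same.\<close>
  then show ?thesis
    using q unfolding Infty D0.simps Sq_chart_inf_eq_Pt[OF q]
    by (simp add: Sq_def D0_coeff_def D0_coeff_inf_def field_simps)
next
  case (Pt z)
  show ?thesis
  proof (cases "z = 0")
    case True
    have "deriv (\<lambda>x. f (chart_inf (- q * x))) 0 = - q * deriv (\<lambda>w. f (chart_inf w)) 0"
      using f Pt True deriv_mult_left_arg[of "\<lambda>w. f (chart_inf w)" "- q" 0] by simp
    moreover have "chart_inf 0 = Infty"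
      by (simp add: chart_inf_def)
    ultimately show ?thesis
      using True unfolding Pt D0.simps Sq_Pt_eq_chart_inf[OF q]
      by (simp add: Sq_def D0_coeff_def D0_coeff_inf_def field_simps)
  next
    case False
    define g where "g = (\<lambda>x. f (Pt x))"
    define s where "s = - (1 / (q * z))"
    have "(g has_field_derivative deriv g s) (at s)"
      using f Pt False by (simp add: g_def s_def field_differentiable_derivI)
    moreover have "((\<lambda>x. - (1 / (q * x))) has_field_derivative 1 / (q * z\<^sup>2)) (at z)"
      using q False by (auto intro!: derivative_eq_intros simp: field_simps power2_eq_square)
    ultimately have "((\<lambda>x. g (- (1 / (q * x)))) has_field_derivative deriv g s * (1 / (q * z\<^sup>2))) (at z)"
      unfolding s_def by (rule DERIV_chain2)
    \<comment> \<open>\<open>Sq_point\<close> sends 0 to \<open>Infty\<close>, so the formula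
      through \<open>g\<close> is transferred on the open set of nonzero x.\<close>
    then have "((\<lambda>x. Sq q f (Pt x)) has_field_derivative deriv g s * (1 / (q * z\<^sup>2))) (at z)"
      by (rule has_field_derivative_transform_within_open[where S = "- {0}"])
         (use False in \<open>auto simp: Sq_def g_def\<close>)
    then have "deriv (\<lambda>x. Sq q f (Pt x)) z = deriv g s / (q * z\<^sup>2)"
      by (simp add: DERIV_imp_deriv)
    moreover have "Sq q (D0 q f) (Pt z) = D0_coeff q s * deriv g s"
      using False by (simp add: Sq_def s_def g_def)
    ultimately show ?thesis
      using q False by (simp add: Pt s_def D0_coeff_Sq)
  qed
qed

lemma rat_const_diff: "rat_const (a - b) = rat_const a - rat_const b"
  using rat_const_add[of "a - b" b] by simp

lemma rat_deriv_add: "rat_deriv (f + g) = rat_deriv f + rat_deriv g"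
proof (cases f; cases g)
  fix a b c d :: "'a poly"
  assume "f = Fract a b" "b \<noteq> 0" "g = Fract c d" "d \<noteq> 0"
  then show ?thesis
    by (simp add: rat_deriv_Fract eq_fract pderiv_mult pderiv_add algebra_simps)
qed

lemma rat_deriv_mult: "rat_deriv (f * g) = rat_deriv f * g + f * rat_deriv g"
proof (cases f; cases g)
  fix a b c d :: "'a poly"
  assume "f = Fract a b" "b \<noteq> 0" "g = Fract c d" "d \<noteq> 0"
  then show ?thesis
    by (simp add: rat_deriv_Fract eq_fract pderiv_mult algebra_simps)
qed

lemma rat_deriv_to_fract: "rat_deriv (to_fract p) = to_fract (pderiv p)"
  by (simp add: to_fract_def rat_deriv_Fract)

lemma rat_deriv_const [simp]: "rat_deriv (rat_const c) = 0"
  by (simp add: rat_const_def rat_deriv_to_fract pderiv_pCons)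

lemma rat_deriv_x [simp]: "rat_deriv rat_x = 1"
  by (simp add: rat_x_def rat_deriv_to_fract pderiv_pCons flip: one_pCons)

text \<open>The product rule for f = (f/g) * g, solved for the derivative of f/g. Unlike
  \<open>rat_deriv_Fract\<close>, it lets f and g be rational functions, as they are after the
  substitution.\<close>

lemma rat_deriv_divide:
  assumes "g \<noteq> 0"
  shows "rat_deriv (f / g) = (rat_deriv f * g - f * rat_deriv g) / g\<^sup>2"
proof -
  have "rat_deriv f = rat_deriv (f / g) * g + f / g * rat_deriv g"
    using assms rat_deriv_mult[of "f / g" g] by simp
  then show ?thesis
    using assms by (simp add: field_simps power2_eq_square)
qed

text \<open>The chain rule for a polynomial in s, by the product rule along the Horner form c + s *
  p(s).\<close>

lemma rat_deriv_eval: "rat_deriv (rat_eval p s) = rat_eval (pderiv p) s * rat_deriv s"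
proof (induction p)
  case 0
  then show ?case
    using rat_deriv_const[of 0] by simp
next
  case (pCons c p)
  then show ?case
    by (simp add: pderiv_pCons rat_deriv_add rat_deriv_mult rat_eval_add algebra_simps)
qed

lemma D0_rat_Sq_rat_anticommute:
  fixes q :: "'k::field"
  assumes q: "q \<noteq> 0"
  shows "D0_rat q (Sq_rat q f) + Sq_rat q (D0_rat q f) = 0"
proof (cases f)
  case (Fract a b)
  define s :: "'k poly fract" where "s = - (1 / (rat_const q * rat_x))"
  \<comment> \<open>The derivative of a/b is N/b^2; both terms of the sum will be multiples of
    N(s)/B^2.\<close>
  define N where "N = pderiv a * b - a * pderiv b"
  define B where "B = rat_eval b s"
  have x: "rat_x \<noteq> (0 :: 'k poly fract)"
    by (simp add: rat_x_def)
  have B: "B \<noteq> 0"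
    using Fract rat_eval_Sq_nonzero[OF q] by (simp add: B_def s_def)
  have m1: "rat_const (- 1) = (- 1 :: 'k poly fract)"
    using rat_const_diff[of 0 1] by simp
  then have "s = rat_const (- 1) / (rat_const q * rat_x)"
    by (simp add: s_def)
  then have "rat_deriv s = - (rat_const (- 1) * rat_const q) / (rat_const q * rat_x)\<^sup>2"
    using q x by (simp add: rat_deriv_divide rat_deriv_mult)
  then have ds: "rat_deriv s = 1 / (rat_const q * rat_x\<^sup>2)"
    using q by (simp add: m1 power2_eq_square)
  have N: "rat_eval N s = rat_eval (pderiv a) s * B - rat_eval a s * rat_eval (pderiv b) s"
    using rat_eval_add[of N "a * pderiv b" s] by (simp add: N_def B_def rat_eval_mult)
  have "rat_deriv B = rat_eval (pderiv b) s * rat_deriv s"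
    by (simp add: B_def rat_deriv_eval)
  moreover have "Sq_rat q f = rat_eval a s / B"
    using Fract q by (simp add: Sq_rat_Fract s_def B_def)
  ultimately have "rat_deriv (Sq_rat q f) = rat_eval N s / B\<^sup>2 * rat_deriv s"
    using B by (simp add: rat_deriv_divide rat_deriv_eval N algebra_simps)
  moreover have "Sq_rat q (D0_rat q f) = D0_coeff (rat_const q) s * (rat_eval N s / B\<^sup>2)"
  proof -
    \<comment> \<open>The coefficient of \<open>D0_rat\<close> as a polynomial in x: then
      \<open>D0_rat q f\<close> is one fraction of polynomials, to which \<open>Sq_rat_Fract\<close>
      applies.\<close>
    define p where "p = [:1 - q, q:] * [:1, q - 1:]"
    have const: "rat_const (1 - q) = 1 - rat_const q" "rat_const (q - 1) = rat_const q - 1"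
      by (simp_all add: rat_const_diff)
    have p: "rat_eval p u = D0_coeff (rat_const q) u" for u
      unfolding p_def rat_eval_mult by (simp add: D0_coeff_def const algebra_simps)
    have "D0_rat q f = to_fract p * Fract N (b * b)"
      using Fract p[of rat_x] rat_eval_to_fract[of p "[:0, 1:]"]
      by (simp add: D0_rat_def rat_deriv_Fract N_def rat_x_def)
    also have "\<dots> = Fract (p * N) (b * b)"
      by (simp add: to_fract_def)
    finally show ?thesis
      using Fract q
      by (simp add: Sq_rat_Fract rat_eval_mult p B_def power2_eq_square flip: s_def)
  qed
  ultimately have "D0_rat q (Sq_rat q f) + Sq_rat q (D0_rat q f) =
      (D0_coeff (rat_const q) rat_x * rat_deriv s + D0_coeff (rat_const q) s) * (rat_eval N s / B\<^sup>2)"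
    by (simp add: D0_rat_def algebra_simps)
  \<comment> \<open>The identity is used in the field K(x), with \<open>rat_const q\<close> and
    \<open>rat_x\<close> as its two nonzero elements.\<close>
  also have "D0_coeff (rat_const q) s = - D0_coeff (rat_const q) rat_x / (rat_const q * rat_x\<^sup>2)"
    using q x unfolding s_def by (intro D0_coeff_Sq) auto
  finally show ?thesis
    by (simp add: ds)
qed

theorem proposition2p2:
  shows "(\<forall>(q :: complex) (f :: P1 \<Rightarrow> complex) (t :: P1).
            q \<noteq> 0 \<longrightarrow> P1_differentiable_at f (Sq_point q t) \<longrightarrow>
            (D0 q \<circ> Sq q) f t + (Sq q \<circ> D0 q) f t = 0)
       \<and> (\<forall>(q :: 'k::field) (f :: 'k poly fract).
            q \<noteq> 0 \<longrightarrow> (D0_rat q \<circ> Sq_rat q) f + (Sq_rat q \<circ> D0_rat q) f = 0)"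
  using D0_Sq_anticommute D0_rat_Sq_rat_anticommute by auto

end
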